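(* Let $\mathcal{D}_h,\mathcal{D}_l$ be NDBATs, $m$ an NDBAT refinement mapping from $\mathcal{D}_h$ to $\mathcal{D}_l$ proper wrt $\mathcal{D}_l$, $M_h\models\mathcal{D}_h\cup\mathcal{C}$, $M_l\models\mathcal{D}_l\cup\mathcal{C}$, and suppose $M_h\sim_m M_l$. Then for any sequence $\vec\alpha$ of high-level system actions, any high-level situation-suppressed formula $\phi$ and any variable assignment $v$: $M_l,v\models\exists s'.Do(m_s(\vec\alpha),S_0,s')\wedge m_f(\phi)[s']$ if and only if $M_h,v\models Executable(do(\vec\alpha,S_0))\wedge\phi[do(\vec\alpha,S_0)]$.
   Context: Framework: the situation calculus. Situations: $S_0$ and $do(a,s)$; $do([a_1,\dots,a_n],s)$ abbreviates $do(a_n,\dots do(a_1,s)\dots)$. $Executable(s)$ means every action performed in reaching $s$ was possible when performed. A situation-suppressed formula is one with situation arguments of fluents removed; $\phi[s]$ restores $s$. $M,v\models\phi$: model $M$ and variable assignment $v$ satisfy $\phi$; $v[x/d]$ is $v$ modified at $x$. $\vec\alpha$ may contain free variables in action parameters, but its action function symbols are given. NDBAT: a basic action theory (foundational axioms, initial-state axioms, unique-name axioms for actions, successor state axioms, precondition axioms $Poss(A(\vec x,e),s)\equiv\phi^{Poss}_A(\vec x,e,s)$) in which every action function $A(\vec x,e)$ has a final argument $e$ of sort Reaction. $A(\vec x,e)$ is a system action, $A(\vec x)$ the agent action, with agent precondition $Poss_{ag}(A(\vec x),s)$; the theory entails $\forall e.Poss(A(\vec x,e),s)\supset Poss_{ag}(A(\vec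 x),s)$ and $Poss_{ag}(A(\vec x),s)\supset\exists e.Poss(A(\vec x,e),s)$. ConGolog programs $\delta::=\alpha\mid\varphi?\mid\delta_1;\delta_2\mid\delta_1|\delta_2\mid\pi x.\delta\mid\delta^*\mid\delta_1\|\delta_2$ ($nil=True?$). $\mathcal{C}$ axiomatizes $Trans,Final$: $Trans(\alpha,s,\delta',s')\equiv s'=do(\alpha,s)\wedge Poss(\alpha,s)\wedge\delta'=True?$; $Trans(\varphi?,s,\delta',s')\equiv False$; $Trans(\delta_1;\delta_2,s,\delta',s')\equiv(Trans(\delta_1,s,\delta_1',s')\wedge\delta'=\delta_1';\delta_2)\vee(Final(\delta_1,s)\wedge Trans(\delta_2,s,\delta',s'))$; choice: disjunction; $\pi$: existential; $Trans(\delta^*,s,\delta',s')\equiv Trans(\delta,s,\delta'',s')\wedge\delta'=\delta'';\delta^*$; $\|$: interleaving. $Final(\alpha,s)\equiv False$, $Final(\varphi?,s)\equiv\varphi[s]$, sequence and $\|$: conjunction, choice: disjunction, $\pi$: existential, $Final(\delta^*,s)\equiv True$. $Do(\delta,s,s')\doteq\exists\delta'.Trans^*(\delta,s,\delta',s')\wedge Final(\delta',s')$. Agent programs (atoms are agent actions) use $Trans(A(\vec x),s,\delta',s')\equiv\exists e.Poss(A(\vec x,e),s)\wedge\delta'=True?\wedge s'=do(A(\vec x,e),s)$; $Do_{ag}$ is $Do$ under this semantics. SD: $Trans^*(\delta,s,\delta',s')\wedge Trans^*(\delta,s,\delta'',s')\supset\delta'=\delta''$. Abstraction setting: high-level NDBAT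 $\mathcal{D}_h$ (finite action types $\mathcal{A}_h$, fluents $\mathcal{F}_h$), low-level NDBAT $\mathcal{D}_l$, sharing only a countably infinite set of standard object names (unique names, domain closure; Reaction a subsort of Object); no functions other than constants, no non-fluent predicates. A refinement mapping $m=\langle m_a,m_s,m_f\rangle$ maps each $A\in\mathcal{A}_h$ to an SD low-level agent program $m_a(A(\vec x))$ and an SD low-level system program $m_s(A(\vec x,e))$, and each high-level fluent $F(\vec x)$ to a situation-suppressed low-level formula $m_f(F(\vec x))$; extended to sequences by composition with ";" ($m(\epsilon)=nil$), and to formulas: $m_f(\phi)$ replaces each high-level fluent by its image. Proper wrt $\mathcal{D}_l$: for all high-level system action sequences $\vec\alpha$ and $A$, $\mathcal{D}_l\cup\mathcal{C}\models\forall s.(Do(m_s(\vec\alpha),S_0,s)\supset\forall\vec x,s'.(Do_{ag}(m_a(A(\vec x)),s,s')\equiv\exists e.Do(m_s(A(\vec x,e)),s,s')))$. $s_h\sim_m^{M_h,M_l}s_l$ iff for every $F\in\mathcal{F}_h$ and assignment $v$: $M_h,v[s/s_h]\models F(\vec x,s)$ iff $M_l,v[s/s_l]\models m_f(F(\vec x))[s]$. An $m$-bisimulation $B$ satisfies, for $\langle s_h,s_l\rangle\in B$: (i) $s_h\sim_m^{M_h,M_l}s_l$; (ii) for each $A\in\mathcal{A}_h$, if $M_h,v[s/s_h,s'/s_h']\models Poss(A(\vec x,e),s)\wedge s'=do(A(\vec x,e),s)$ then some $s_l'$ has $M_l,v[s/s_l,s'/s_l']\models Do(m_s(A(\vec x,e)),s,s')$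 and $\langle s_h',s_l'\rangle\in B$; (iii) conversely from $Do(m_s(A(\vec x,e)),s_l,s_l')$ to some $s_h'=do(A(\vec x,e),s_h)$ with $Poss$ and $\langle s_h',s_l'\rangle\in B$. $M_h\sim_m M_l$ iff some $m$-bisimulation relates $S_0^{M_h}$ and $S_0^{M_l}$. *)

theory Defs
  imports Main "HOL-Library.Countable"
begin

section \<open>Standard names, terms and formulas\<close>

text \<open>
  By unique names and domain closure the standard object names serve as the object domain of
  every model, so that assignments to object variables are shared by all models.
  \<open>Reaction\<close> is the extension of the subsort of reactions.
\<close>

class standard_name = countable +
  fixes Reaction :: "'a set"
  assumes infinite_names: "infinite (UNIV :: 'a set)"
    and Reaction_nonempty: "Reaction \<noteq> {}"

text \<open>
  Variables are de Bruijn indices, with separate index spaces for variables of sort Object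
  (\<open>OVar\<close>), Reaction (\<open>RVar\<close>) and Action (\<open>AVar\<close>).
\<close>

datatype 'n tm = Name 'n | OVar nat | RVar nat

datatype ('n, 'A) sysact = Sys 'A "'n tm list" "'n tm"

datatype ('n, 'A) aterm = AVar nat | AFun "('n, 'A) sysact"

text \<open>
  Situation-suppressed formulas. Terms of sort Action are only compared by \<open>AEq\<close>; they are
  needed for the right-hand sides of successor state axioms.
\<close>

datatype ('n, 'A, 'F) fm =
    Tru
  | Rel 'F "'n tm list"
  | OEq "'n tm" "'n tm"
  | AEq "('n, 'A) aterm" "('n, 'A) aterm"
  | Neg "('n, 'A, 'F) fm"
  | And "('n, 'A, 'F) fm" "('n, 'A, 'F) fm"
  | AllO "('n, 'A, 'F) fm"
  | AllR "('n, 'A, 'F) fm"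
  | AllA "('n, 'A, 'F) fm"

primrec object_fm :: "('n, 'A, 'F) fm \<Rightarrow> bool" where
  "object_fm Tru \<longleftrightarrow> True"
| "object_fm (Rel F ts) \<longleftrightarrow> True"
| "object_fm (OEq t u) \<longleftrightarrow> True"
| "object_fm (AEq a b) \<longleftrightarrow> False"
| "object_fm (Neg p) \<longleftrightarrow> object_fm p"
| "object_fm (And p q) \<longleftrightarrow> object_fm p \<and> object_fm q"
| "object_fm (AllO p) \<longleftrightarrow> object_fm p"
| "object_fm (AllR p) \<longleftrightarrow> object_fm p"
| "object_fm (AllA p) \<longleftrightarrow> False"

text \<open>
  ConGolog programs. \<open>Prim\<close> is a system action \<open>A(x,e)\<close>, \<open>Agent\<close> an agent action \<open>A(x)\<close>;
  \<open>PiO\<close> and \<open>PiR\<close> are the nondeterministic pick of an object and of a reaction.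
\<close>

datatype ('n, 'A, 'F) prog =
    Prim "('n, 'A) sysact"
  | Agent 'A "'n tm list"
  | Test "('n, 'A, 'F) fm"
  | Seq "('n, 'A, 'F) prog" "('n, 'A, 'F) prog"
  | Choice "('n, 'A, 'F) prog" "('n, 'A, 'F) prog"
  | PiO "('n, 'A, 'F) prog"
  | PiR "('n, 'A, 'F) prog"
  | Star "('n, 'A, 'F) prog"
  | Conc "('n, 'A, 'F) prog" "('n, 'A, 'F) prog"

abbreviation nil_prog :: "('n, 'A, 'F) prog" where
  "nil_prog \<equiv> Test Tru"

primrec system_prog :: "('n, 'A, 'F) prog \<Rightarrow> bool" where
  "system_prog (Prim a) \<longleftrightarrow> True"
| "system_prog (Agent A ts) \<longleftrightarrow> False"
| "system_prog (Test p) \<longleftrightarrow> True"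
| "system_prog (Seq d1 d2) \<longleftrightarrow> system_prog d1 \<and> system_prog d2"
| "system_prog (Choice d1 d2) \<longleftrightarrow> system_prog d1 \<and> system_prog d2"
| "system_prog (PiO d) \<longleftrightarrow> system_prog d"
| "system_prog (PiR d) \<longleftrightarrow> system_prog d"
| "system_prog (Star d) \<longleftrightarrow> system_prog d"
| "system_prog (Conc d1 d2) \<longleftrightarrow> system_prog d1 \<and> system_prog d2"

primrec agent_prog :: "('n, 'A, 'F) prog \<Rightarrow> bool" where
  "agent_prog (Prim a) \<longleftrightarrow> False"
| "agent_prog (Agent A ts) \<longleftrightarrow> True"
| "agent_prog (Test p) \<longleftrightarrow> True"
| "agent_prog (Seq d1 d2) \<longleftrightarrow> agent_prog d1 \<and> agent_prog d2"
| "agent_prog (Choice d1 d2) \<longleftrightarrow> agent_prog d1 \<and> agent_prog d2"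
| "agent_prog (PiO d) \<longleftrightarrow> agent_prog d"
| "agent_prog (PiR d) \<longleftrightarrow> agent_prog d"
| "agent_prog (Star d) \<longleftrightarrow> agent_prog d"
| "agent_prog (Conc d1 d2) \<longleftrightarrow> agent_prog d1 \<and> agent_prog d2"

subsection \<open>Free variables\<close>

text \<open>
  \<open>closed_\<dots> i j k\<close>: the free variables are among the first \<open>i\<close> object, the first \<open>j\<close> reaction
  and the first \<open>k\<close> action variables. Programs have no free action variables.
\<close>

primrec closed_tm :: "nat \<Rightarrow> nat \<Rightarrow> 'n tm \<Rightarrow> bool" where
  "closed_tm i j (Name n) \<longleftrightarrow> True"
| "closed_tm i j (OVar x) \<longleftrightarrow> x < i"
| "closed_tm i j (RVar x) \<longleftrightarrow> x < j"

primrec closed_sysact :: "nat \<Rightarrow> nat \<Rightarrow> ('n, 'A) sysact \<Rightarrow> bool" where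
  "closed_sysact i j (Sys A ts e) \<longleftrightarrow> (\<forall>t \<in> set ts. closed_tm i j t) \<and> closed_tm i j e"

primrec closed_aterm :: "nat \<Rightarrow> nat \<Rightarrow> nat \<Rightarrow> ('n, 'A) aterm \<Rightarrow> bool" where
  "closed_aterm i j k (AVar x) \<longleftrightarrow> x < k"
| "closed_aterm i j k (AFun a) \<longleftrightarrow> closed_sysact i j a"

primrec closed_fm :: "nat \<Rightarrow> nat \<Rightarrow> nat \<Rightarrow> ('n, 'A, 'F) fm \<Rightarrow> bool" where
  "closed_fm i j k Tru \<longleftrightarrow> True"
| "closed_fm i j k (Rel F ts) \<longleftrightarrow> (\<forall>t \<in> set ts. closed_tm i j t)"
| "closed_fm i j k (OEq t u) \<longleftrightarrow> closed_tm i j t \<and> closed_tm i j u"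
| "closed_fm i j k (AEq a b) \<longleftrightarrow> closed_aterm i j k a \<and> closed_aterm i j k b"
| "closed_fm i j k (Neg p) \<longleftrightarrow> closed_fm i j k p"
| "closed_fm i j k (And p q) \<longleftrightarrow> closed_fm i j k p \<and> closed_fm i j k q"
| "closed_fm i j k (AllO p) \<longleftrightarrow> closed_fm (Suc i) j k p"
| "closed_fm i j k (AllR p) \<longleftrightarrow> closed_fm i (Suc j) k p"
| "closed_fm i j k (AllA p) \<longleftrightarrow> closed_fm i j (Suc k) p"

primrec closed_prog :: "nat \<Rightarrow> nat \<Rightarrow> ('n, 'A, 'F) prog \<Rightarrow> bool" where
  "closed_prog i j (Prim a) \<longleftrightarrow> closed_sysact i j a"
| "closed_prog i j (Agent A ts) \<longleftrightarrow> (\<forall>t \<in> set ts. closed_tm i j t)"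
| "closed_prog i j (Test p) \<longleftrightarrow> closed_fm i j 0 p"
| "closed_prog i j (Seq d1 d2) \<longleftrightarrow> closed_prog i j d1 \<and> closed_prog i j d2"
| "closed_prog i j (Choice d1 d2) \<longleftrightarrow> closed_prog i j d1 \<and> closed_prog i j d2"
| "closed_prog i j (PiO d) \<longleftrightarrow> closed_prog (Suc i) j d"
| "closed_prog i j (PiR d) \<longleftrightarrow> closed_prog i (Suc j) d"
| "closed_prog i j (Star d) \<longleftrightarrow> closed_prog i j d"
| "closed_prog i j (Conc d1 d2) \<longleftrightarrow> closed_prog i j d1 \<and> closed_prog i j d2"

subsection \<open>Capture-avoiding substitution\<close>

text \<open>\<open>f\<close> is the substitution for object variables, \<open>g\<close> the one for reaction variables.\<close>

primrec liftO :: "'n tm \<Rightarrow> 'n tm" where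
  "liftO (Name n) = Name n"
| "liftO (OVar x) = OVar (Suc x)"
| "liftO (RVar x) = RVar x"

primrec liftR :: "'n tm \<Rightarrow> 'n tm" where
  "liftR (Name n) = Name n"
| "liftR (OVar x) = OVar x"
| "liftR (RVar x) = RVar (Suc x)"

abbreviation underO :: "(nat \<Rightarrow> 'n tm) \<Rightarrow> nat \<Rightarrow> 'n tm" where
  "underO f \<equiv> case_nat (OVar 0) (liftO \<circ> f)"

abbreviation underR :: "(nat \<Rightarrow> 'n tm) \<Rightarrow> nat \<Rightarrow> 'n tm" where
  "underR g \<equiv> case_nat (RVar 0) (liftR \<circ> g)"

primrec subst_tm :: "(nat \<Rightarrow> 'n tm) \<Rightarrow> (nat \<Rightarrow> 'n tm) \<Rightarrow> 'n tm \<Rightarrow> 'n tm" where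
  "subst_tm f g (Name n) = Name n"
| "subst_tm f g (OVar x) = f x"
| "subst_tm f g (RVar x) = g x"

primrec subst_sysact ::
  "(nat \<Rightarrow> 'n tm) \<Rightarrow> (nat \<Rightarrow> 'n tm) \<Rightarrow> ('n, 'A) sysact \<Rightarrow> ('n, 'A) sysact" where
  "subst_sysact f g (Sys A ts e) = Sys A (map (subst_tm f g) ts) (subst_tm f g e)"

primrec subst_aterm ::
  "(nat \<Rightarrow> 'n tm) \<Rightarrow> (nat \<Rightarrow> 'n tm) \<Rightarrow> ('n, 'A) aterm \<Rightarrow> ('n, 'A) aterm" where
  "subst_aterm f g (AVar x) = AVar x"
| "subst_aterm f g (AFun a) = AFun (subst_sysact f g a)"

primrec subst_fm ::
  "(nat \<Rightarrow> 'n tm) \<Rightarrow> (nat \<Rightarrow> 'n tm) \<Rightarrow> ('n, 'A, 'F) fm \<Rightarrow> ('n, 'A, 'F) fm" where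
  "subst_fm f g Tru = Tru"
| "subst_fm f g (Rel F ts) = Rel F (map (subst_tm f g) ts)"
| "subst_fm f g (OEq t u) = OEq (subst_tm f g t) (subst_tm f g u)"
| "subst_fm f g (AEq a b) = AEq (subst_aterm f g a) (subst_aterm f g b)"
| "subst_fm f g (Neg p) = Neg (subst_fm f g p)"
| "subst_fm f g (And p q) = And (subst_fm f g p) (subst_fm f g q)"
| "subst_fm f g (AllO p) = AllO (subst_fm (underO f) (liftO \<circ> g) p)"
| "subst_fm f g (AllR p) = AllR (subst_fm (liftR \<circ> f) (underR g) p)"
| "subst_fm f g (AllA p) = AllA (subst_fm f g p)"

primrec subst_prog ::
  "(nat \<Rightarrow> 'n tm) \<Rightarrow> (nat \<Rightarrow> 'n tm) \<Rightarrow> ('n, 'A, 'F) prog \<Rightarrow> ('n, 'A, 'F) prog" where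
  "subst_prog f g (Prim a) = Prim (subst_sysact f g a)"
| "subst_prog f g (Agent A ts) = Agent A (map (subst_tm f g) ts)"
| "subst_prog f g (Test p) = Test (subst_fm f g p)"
| "subst_prog f g (Seq d1 d2) = Seq (subst_prog f g d1) (subst_prog f g d2)"
| "subst_prog f g (Choice d1 d2) = Choice (subst_prog f g d1) (subst_prog f g d2)"
| "subst_prog f g (PiO d) = PiO (subst_prog (underO f) (liftO \<circ> g) d)"
| "subst_prog f g (PiR d) = PiR (subst_prog (liftR \<circ> f) (underR g) d)"
| "subst_prog f g (Star d) = Star (subst_prog f g d)"
| "subst_prog f g (Conc d1 d2) = Conc (subst_prog f g d1) (subst_prog f g d2)"

section \<open>Structures and satisfaction\<close>

text \<open>
  \<open>'a\<close> and \<open>'s\<close> are the action and situation domains; \<open>result\<close> interprets the function \<open>do\<close> and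
  \<open>prec\<close> the relation \<open>\<sqsubset>\<close> on situations. The domain of \<open>Trans\<close> and \<open>Final\<close> consists of the
  program terms themselves.
\<close>

record ('n, 'A, 'F, 'a, 's) interp =
  act :: "'A \<Rightarrow> 'n list \<Rightarrow> 'n \<Rightarrow> 'a"
  S0 :: 's
  result :: "'a \<Rightarrow> 's \<Rightarrow> 's"
  prec :: "'s \<Rightarrow> 's \<Rightarrow> bool"
  Poss :: "'a \<Rightarrow> 's \<Rightarrow> bool"
  holds :: "'F \<Rightarrow> 'n list \<Rightarrow> 's \<Rightarrow> bool"
  Trans :: "('n, 'A, 'F) prog \<Rightarrow> 's \<Rightarrow> ('n, 'A, 'F) prog \<Rightarrow> 's \<Rightarrow> bool"
  Final :: "('n, 'A, 'F) prog \<Rightarrow> 's \<Rightarrow> bool"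

record 'n asg =
  ovar :: "nat \<Rightarrow> 'n"
  rvar :: "nat \<Rightarrow> 'n"

definition assignment :: "'n::standard_name asg \<Rightarrow> bool" where
  "assignment v \<longleftrightarrow> (\<forall>x. rvar v x \<in> Reaction)"

primrec val :: "'n asg \<Rightarrow> 'n tm \<Rightarrow> 'n" where
  "val v (Name n) = n"
| "val v (OVar x) = ovar v x"
| "val v (RVar x) = rvar v x"

primrec val_sysact :: "('n, 'A, 'F, 'a, 's) interp \<Rightarrow> 'n asg \<Rightarrow> ('n, 'A) sysact \<Rightarrow> 'a" where
  "val_sysact M v (Sys A ts e) = act M A (map (val v) ts) (val v e)"

primrec val_aterm ::
  "('n, 'A, 'F, 'a, 's) interp \<Rightarrow> 'n asg \<Rightarrow> (nat \<Rightarrow> 'a) \<Rightarrow> ('n, 'A) aterm \<Rightarrow> 'a" where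
  "val_aterm M v w (AVar x) = w x"
| "val_aterm M v w (AFun a) = val_sysact M v a"

text \<open>
  \<open>sat M v w s \<phi>\<close> is \<open>M,v \<Turnstile> \<phi>[s]\<close>, where \<open>w\<close> is the part of the assignment that concerns action
  variables (the action domains of different models are unrelated).
\<close>

primrec sat ::
  "('n::standard_name, 'A, 'F, 'a, 's) interp \<Rightarrow> 'n asg \<Rightarrow> (nat \<Rightarrow> 'a) \<Rightarrow> 's \<Rightarrow>
   ('n, 'A, 'F) fm \<Rightarrow> bool" where
  "sat M v w s Tru \<longleftrightarrow> True"
| "sat M v w s (Rel F ts) \<longleftrightarrow> holds M F (map (val v) ts) s"
| "sat M v w s (OEq t u) \<longleftrightarrow> val v t = val v u"
| "sat M v w s (AEq a b) \<longleftrightarrow> val_aterm M v w a = val_aterm M v w b"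
| "sat M v w s (Neg p) \<longleftrightarrow> \<not> sat M v w s p"
| "sat M v w s (And p q) \<longleftrightarrow> sat M v w s p \<and> sat M v w s q"
| "sat M v w s (AllO p) \<longleftrightarrow> (\<forall>d. sat M (v\<lparr>ovar := case_nat d (ovar v)\<rparr>) w s p)"
| "sat M v w s (AllR p) \<longleftrightarrow> (\<forall>d \<in> Reaction. sat M (v\<lparr>rvar := case_nat d (rvar v)\<rparr>) w s p)"
| "sat M v w s (AllA p) \<longleftrightarrow> (\<forall>a. sat M v (case_nat a w) s p)"

definition prec_eq :: "('n, 'A, 'F, 'a, 's) interp \<Rightarrow> 's \<Rightarrow> 's \<Rightarrow> bool" where
  "prec_eq M s s' \<longleftrightarrow> prec M s s' \<or> s = s'"

definition Executable :: "('n, 'A, 'F, 'a, 's) interp \<Rightarrow> 's \<Rightarrow> bool" where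
  "Executable M s \<longleftrightarrow> (\<forall>a s'. prec_eq M (result M a s') s \<longrightarrow> Poss M a s')"

definition result_seq ::
  "('n, 'A, 'F, 'a, 's) interp \<Rightarrow> 'n asg \<Rightarrow> ('n, 'A) sysact list \<Rightarrow> 's \<Rightarrow> 's" where
  "result_seq M v as s = fold (\<lambda>a. result M (val_sysact M v a)) as s"

section \<open>Nondeterministic basic action theories\<close>

text \<open>
  The parameters of an action or fluent symbol are the first object variables; the reaction
  parameter of an action is reaction variable 0, and the action variable of a successor state
  axiom is action variable 0.
\<close>

record ('n, 'A, 'F) bat =
  actions :: "'A set"
  fluents :: "'F set"
  act_arity :: "'A \<Rightarrow> nat"
  flu_arity :: "'F \<Rightarrow> nat"
  init_axioms :: "('n, 'A, 'F) fm set"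
  poss_fm :: "'A \<Rightarrow> ('n, 'A, 'F) fm"
  poss_ag_fm :: "'A \<Rightarrow> ('n, 'A, 'F) fm"
  ssa_fm :: "'F \<Rightarrow> ('n, 'A, 'F) fm"

definition generic_act :: "('n, 'A, 'F) bat \<Rightarrow> 'A \<Rightarrow> ('n, 'A) sysact" where
  "generic_act D A = Sys A (map OVar [0..<act_arity D A]) (RVar 0)"

definition generic_flu :: "('n, 'A, 'F) bat \<Rightarrow> 'F \<Rightarrow> ('n, 'A, 'F) fm" where
  "generic_flu D F = Rel F (map OVar [0..<flu_arity D F])"

primrec reaction_tm :: "'n::standard_name tm \<Rightarrow> bool" where
  "reaction_tm (Name n) \<longleftrightarrow> n \<in> Reaction"
| "reaction_tm (OVar x) \<longleftrightarrow> False"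
| "reaction_tm (RVar x) \<longleftrightarrow> True"

primrec wf_sysact :: "('n::standard_name, 'A, 'F) bat \<Rightarrow> ('n, 'A) sysact \<Rightarrow> bool" where
  "wf_sysact D (Sys A ts e) \<longleftrightarrow> A \<in> actions D \<and> length ts = act_arity D A \<and> reaction_tm e"

primrec wf_aterm :: "('n::standard_name, 'A, 'F) bat \<Rightarrow> ('n, 'A) aterm \<Rightarrow> bool" where
  "wf_aterm D (AVar x) \<longleftrightarrow> True"
| "wf_aterm D (AFun a) \<longleftrightarrow> wf_sysact D a"

primrec wf_fm :: "('n::standard_name, 'A, 'F) bat \<Rightarrow> ('n, 'A, 'F) fm \<Rightarrow> bool" where
  "wf_fm D Tru \<longleftrightarrow> True"
| "wf_fm D (Rel F ts) \<longleftrightarrow> F \<in> fluents D \<and> length ts = flu_arity D F"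
| "wf_fm D (OEq t u) \<longleftrightarrow> True"
| "wf_fm D (AEq a b) \<longleftrightarrow> wf_aterm D a \<and> wf_aterm D b"
| "wf_fm D (Neg p) \<longleftrightarrow> wf_fm D p"
| "wf_fm D (And p q) \<longleftrightarrow> wf_fm D p \<and> wf_fm D q"
| "wf_fm D (AllO p) \<longleftrightarrow> wf_fm D p"
| "wf_fm D (AllR p) \<longleftrightarrow> wf_fm D p"
| "wf_fm D (AllA p) \<longleftrightarrow> wf_fm D p"

primrec wf_prog :: "('n::standard_name, 'A, 'F) bat \<Rightarrow> ('n, 'A, 'F) prog \<Rightarrow> bool" where
  "wf_prog D (Prim a) \<longleftrightarrow> wf_sysact D a"
| "wf_prog D (Agent A ts) \<longleftrightarrow> A \<in> actions D \<and> length ts = act_arity D A"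
| "wf_prog D (Test p) \<longleftrightarrow> wf_fm D p"
| "wf_prog D (Seq d1 d2) \<longleftrightarrow> wf_prog D d1 \<and> wf_prog D d2"
| "wf_prog D (Choice d1 d2) \<longleftrightarrow> wf_prog D d1 \<and> wf_prog D d2"
| "wf_prog D (PiO d) \<longleftrightarrow> wf_prog D d"
| "wf_prog D (PiR d) \<longleftrightarrow> wf_prog D d"
| "wf_prog D (Star d) \<longleftrightarrow> wf_prog D d"
| "wf_prog D (Conc d1 d2) \<longleftrightarrow> wf_prog D d1 \<and> wf_prog D d2"

definition foundational_axioms :: "('n, 'A, 'F, 'a, 's) interp \<Rightarrow> bool" where
  "foundational_axioms M \<longleftrightarrow>
     (\<forall>a a' s s'. result M a s = result M a' s' \<longrightarrow> a = a' \<and> s = s') \<and>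
     (\<forall>P. P (S0 M) \<and> (\<forall>a s. P s \<longrightarrow> P (result M a s)) \<longrightarrow> (\<forall>s. P s)) \<and>
     (\<forall>s. \<not> prec M s (S0 M)) \<and>
     (\<forall>a s s'. prec M s (result M a s') \<longleftrightarrow> prec_eq M s s')"

definition unique_action_names ::
  "('n::standard_name, 'A, 'F) bat \<Rightarrow> ('n, 'A, 'F, 'a, 's) interp \<Rightarrow> bool" where
  "unique_action_names D M \<longleftrightarrow>
     (\<forall>A \<in> actions D. \<forall>B \<in> actions D. \<forall>xs ys. \<forall>e \<in> Reaction. \<forall>e' \<in> Reaction.
        length xs = act_arity D A \<and> length ys = act_arity D B \<and> act M A xs e = act M B ys e'
        \<longrightarrow> A = B \<and> xs = ys \<and> e = e')"

definition models_bat ::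
  "('n::standard_name, 'A, 'F, 'a, 's) interp \<Rightarrow> ('n, 'A, 'F) bat \<Rightarrow> bool" where
  "models_bat M D \<longleftrightarrow>
     foundational_axioms M \<and>
     unique_action_names D M \<and>
     (\<forall>p \<in> init_axioms D. \<forall>v w. assignment v \<longrightarrow> sat M v w (S0 M) p) \<and>
     (\<forall>A \<in> actions D. \<forall>v w s. assignment v \<longrightarrow>
        (Poss M (val_sysact M v (generic_act D A)) s \<longleftrightarrow> sat M v w s (poss_fm D A))) \<and>
     (\<forall>F \<in> fluents D. \<forall>v w s. assignment v \<longrightarrow>
        (sat M v w (result M (w 0) s) (generic_flu D F) \<longleftrightarrow> sat M v w s (ssa_fm D F)))"

definition wf_bat :: "('n::standard_name, 'A, 'F) bat \<Rightarrow> bool" where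
  "wf_bat D \<longleftrightarrow>
     (\<forall>p \<in> init_axioms D. wf_fm D p \<and> closed_fm 0 0 0 p) \<and>
     (\<forall>A \<in> actions D.
        wf_fm D (poss_fm D A) \<and> closed_fm (act_arity D A) 1 0 (poss_fm D A) \<and>
        wf_fm D (poss_ag_fm D A) \<and> closed_fm (act_arity D A) 0 0 (poss_ag_fm D A)) \<and>
     (\<forall>F \<in> fluents D. wf_fm D (ssa_fm D F) \<and> closed_fm (flu_arity D F) 0 1 (ssa_fm D F))"

text \<open>
  Entailment quantifies over all structures with the action domain \<open>'a\<close> and the situation domain
  \<open>'s\<close> given by the type argument.
\<close>

definition ndbat :: "('a \<times> 's) itself \<Rightarrow> ('n::standard_name, 'A, 'F) bat \<Rightarrow> bool" where
  "ndbat T D \<longleftrightarrow>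
     wf_bat D \<and>
     (\<forall>(M :: ('n, 'A, 'F, 'a, 's) interp) v w s. \<forall>A \<in> actions D.
        models_bat M D \<and> assignment v \<longrightarrow>
        (\<forall>e \<in> Reaction.
           Poss M (val_sysact M (v\<lparr>rvar := (rvar v)(0 := e)\<rparr>) (generic_act D A)) s
           \<longrightarrow> sat M v w s (poss_ag_fm D A)) \<and>
        (sat M v w s (poss_ag_fm D A) \<longrightarrow>
         (\<exists>e \<in> Reaction.
            Poss M (val_sysact M (v\<lparr>rvar := (rvar v)(0 := e)\<rparr>) (generic_act D A)) s)))"

section \<open>ConGolog\<close>

text \<open>
  The axioms are stated for closed programs, in which every free variable has been replaced by
  the standard name of its value; an agent action is resolved by an arbitrary reaction.
\<close>

definition pick_object :: "'n \<Rightarrow> ('n, 'A, 'F) prog \<Rightarrow> ('n, 'A, 'F) prog" where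
  "pick_object n d = subst_prog (case_nat (Name n) OVar) RVar d"

definition pick_reaction :: "'n \<Rightarrow> ('n, 'A, 'F) prog \<Rightarrow> ('n, 'A, 'F) prog" where
  "pick_reaction n d = subst_prog OVar (case_nat (Name n) RVar) d"

definition trans_axioms :: "('n::standard_name, 'A, 'F, 'a, 's) interp \<Rightarrow> bool" where
  "trans_axioms M \<longleftrightarrow>
     (\<forall>A xs e s d' s'. Trans M (Prim (Sys A (map Name xs) (Name e))) s d' s' \<longleftrightarrow>
        s' = result M (act M A xs e) s \<and> Poss M (act M A xs e) s \<and> d' = nil_prog) \<and>
     (\<forall>A xs s d' s'. Trans M (Agent A (map Name xs)) s d' s' \<longleftrightarrow>
        (\<exists>e \<in> Reaction. Poss M (act M A xs e) s \<and> d' = nil_prog \<and>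
           s' = result M (act M A xs e) s)) \<and>
     (\<forall>p s d' s'. Trans M (Test p) s d' s' \<longleftrightarrow> False) \<and>
     (\<forall>d1 d2 s d' s'. Trans M (Seq d1 d2) s d' s' \<longleftrightarrow>
        (\<exists>d1'. Trans M d1 s d1' s' \<and> d' = Seq d1' d2) \<or> Final M d1 s \<and> Trans M d2 s d' s') \<and>
     (\<forall>d1 d2 s d' s'. Trans M (Choice d1 d2) s d' s' \<longleftrightarrow>
        Trans M d1 s d' s' \<or> Trans M d2 s d' s') \<and>
     (\<forall>d s d' s'. Trans M (PiO d) s d' s' \<longleftrightarrow> (\<exists>n. Trans M (pick_object n d) s d' s')) \<and>
     (\<forall>d s d' s'. Trans M (PiR d) s d' s' \<longleftrightarrow>
        (\<exists>n \<in> Reaction. Trans M (pick_reaction n d) s d' s')) \<and>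
     (\<forall>d s d' s'. Trans M (Star d) s d' s' \<longleftrightarrow>
        (\<exists>d''. Trans M d s d'' s' \<and> d' = Seq d'' (Star d))) \<and>
     (\<forall>d1 d2 s d' s'. Trans M (Conc d1 d2) s d' s' \<longleftrightarrow>
        (\<exists>d1'. Trans M d1 s d1' s' \<and> d' = Conc d1' d2) \<or>
        (\<exists>d2'. Trans M d2 s d2' s' \<and> d' = Conc d1 d2'))"

definition final_axioms :: "('n::standard_name, 'A, 'F, 'a, 's) interp \<Rightarrow> bool" where
  "final_axioms M \<longleftrightarrow>
     (\<forall>a s. Final M (Prim a) s \<longleftrightarrow> False) \<and>
     (\<forall>A ts s. Final M (Agent A ts) s \<longleftrightarrow> False) \<and>
     (\<forall>p s v w. closed_fm 0 0 0 p \<and> assignment v \<longrightarrow> (Final M (Test p) s \<longleftrightarrow> sat M v w s p)) \<and>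
     (\<forall>d1 d2 s. Final M (Seq d1 d2) s \<longleftrightarrow> Final M d1 s \<and> Final M d2 s) \<and>
     (\<forall>d1 d2 s. Final M (Choice d1 d2) s \<longleftrightarrow> Final M d1 s \<or> Final M d2 s) \<and>
     (\<forall>d s. Final M (PiO d) s \<longleftrightarrow> (\<exists>n. Final M (pick_object n d) s)) \<and>
     (\<forall>d s. Final M (PiR d) s \<longleftrightarrow> (\<exists>n \<in> Reaction. Final M (pick_reaction n d) s)) \<and>
     (\<forall>d s. Final M (Star d) s \<longleftrightarrow> True) \<and>
     (\<forall>d1 d2 s. Final M (Conc d1 d2) s \<longleftrightarrow> Final M d1 s \<and> Final M d2 s)"

definition models ::
  "('n::standard_name, 'A, 'F, 'a, 's) interp \<Rightarrow> ('n, 'A, 'F) bat \<Rightarrow> bool" where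
  "models M D \<longleftrightarrow> models_bat M D \<and> trans_axioms M \<and> final_axioms M"

definition Trans_star ::
  "('n, 'A, 'F, 'a, 's) interp \<Rightarrow> ('n, 'A, 'F) prog \<Rightarrow> 's \<Rightarrow> ('n, 'A, 'F) prog \<Rightarrow> 's \<Rightarrow> bool" where
  "Trans_star M d s d' s' \<longleftrightarrow>
     (\<lambda>(d, s) (d', s'). Trans M d s d' s')\<^sup>*\<^sup>* (d, s) (d', s')"

definition instantiate :: "'n asg \<Rightarrow> ('n, 'A, 'F) prog \<Rightarrow> ('n, 'A, 'F) prog" where
  "instantiate v d = subst_prog (Name \<circ> ovar v) (Name \<circ> rvar v) d"

text \<open>
  \<open>Do M v \<delta> s s'\<close> is \<open>M,v \<Turnstile> Do(\<delta>,s,s')\<close>. For agent programs it is \<open>Do\<^sub>a\<^sub>g\<close>, since \<open>Trans\<close> treats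
  agent actions by their own axiom.
\<close>

definition Do ::
  "('n, 'A, 'F, 'a, 's) interp \<Rightarrow> 'n asg \<Rightarrow> ('n, 'A, 'F) prog \<Rightarrow> 's \<Rightarrow> 's \<Rightarrow> bool" where
  "Do M v d s s' \<longleftrightarrow> (\<exists>d'. Trans_star M (instantiate v d) s d' s' \<and> Final M d' s')"

definition SD :: "('n, 'A, 'F, 'a, 's) interp \<Rightarrow> 'n asg \<Rightarrow> ('n, 'A, 'F) prog \<Rightarrow> 's \<Rightarrow> bool" where
  "SD M v d s \<longleftrightarrow>
     (\<forall>s' d' d''. Trans_star M (instantiate v d) s d' s' \<and> Trans_star M (instantiate v d) s d'' s'
        \<longrightarrow> d' = d'')"

section \<open>Refinement mappings and bisimulation\<close>

record ('n, 'Ah, 'Fh, 'Al, 'Fl) mapping =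
  m_a :: "'Ah \<Rightarrow> ('n, 'Al, 'Fl) prog"
  m_s :: "'Ah \<Rightarrow> ('n, 'Al, 'Fl) prog"
  m_f :: "'Fh \<Rightarrow> ('n, 'Al, 'Fl) fm"

definition refinement_mapping ::
  "('a \<times> 's) itself \<Rightarrow> ('n::standard_name, 'Ah, 'Fh) bat \<Rightarrow> ('n, 'Al, 'Fl) bat \<Rightarrow>
   ('n, 'Ah, 'Fh, 'Al, 'Fl) mapping \<Rightarrow> bool" where
  "refinement_mapping T Dh Dl m \<longleftrightarrow>
     (\<forall>A \<in> actions Dh.
        wf_prog Dl (m_a m A) \<and> agent_prog (m_a m A) \<and>
        closed_prog (act_arity Dh A) 0 (m_a m A) \<and>
        wf_prog Dl (m_s m A) \<and> system_prog (m_s m A) \<and>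
        closed_prog (act_arity Dh A) 1 (m_s m A) \<and>
        (\<forall>(M :: ('n, 'Al, 'Fl, 'a, 's) interp) v s. models M Dl \<and> assignment v \<longrightarrow>
           SD M v (m_a m A) s \<and> SD M v (m_s m A) s)) \<and>
     (\<forall>F \<in> fluents Dh. wf_fm Dl (m_f m F) \<and> closed_fm (flu_arity Dh F) 0 0 (m_f m F))"

primrec refine_act ::
  "('n, 'Ah, 'Fh, 'Al, 'Fl) mapping \<Rightarrow> ('n, 'Ah) sysact \<Rightarrow> ('n, 'Al, 'Fl) prog" where
  "refine_act m (Sys A ts e) =
     subst_prog (\<lambda>x. if x < length ts then ts ! x else OVar x) (\<lambda>x. if x = 0 then e else RVar x)
       (m_s m A)"

fun refine_seq ::
  "('n, 'Ah, 'Fh, 'Al, 'Fl) mapping \<Rightarrow> ('n, 'Ah) sysact list \<Rightarrow> ('n, 'Al, 'Fl) prog" where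
  "refine_seq m [] = nil_prog"
| "refine_seq m [a] = refine_act m a"
| "refine_seq m (a # b # as) = Seq (refine_act m a) (refine_seq m (b # as))"

text \<open>
  High-level action terms have no low-level counterpart, so \<open>refine_fm\<close> is meaningful only on
  formulas satisfying \<open>object_fm\<close>.
\<close>

primrec refine_fm ::
  "('n, 'Ah, 'Fh, 'Al, 'Fl) mapping \<Rightarrow> ('n, 'Ah, 'Fh) fm \<Rightarrow> ('n, 'Al, 'Fl) fm" where
  "refine_fm m Tru = Tru"
| "refine_fm m (Rel F ts) =
     subst_fm (\<lambda>x. if x < length ts then ts ! x else OVar x) RVar (m_f m F)"
| "refine_fm m (OEq t u) = OEq t u"
| "refine_fm m (AEq a b) = undefined"
| "refine_fm m (Neg p) = Neg (refine_fm m p)"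
| "refine_fm m (And p q) = And (refine_fm m p) (refine_fm m q)"
| "refine_fm m (AllO p) = AllO (refine_fm m p)"
| "refine_fm m (AllR p) = AllR (refine_fm m p)"
| "refine_fm m (AllA p) = undefined"

definition proper ::
  "('a \<times> 's) itself \<Rightarrow> ('n::standard_name, 'Ah, 'Fh) bat \<Rightarrow> ('n, 'Al, 'Fl) bat \<Rightarrow>
   ('n, 'Ah, 'Fh, 'Al, 'Fl) mapping \<Rightarrow> bool" where
  "proper T Dh Dl m \<longleftrightarrow>
     (\<forall>as. \<forall>A \<in> actions Dh. (\<forall>a \<in> set as. wf_sysact Dh a) \<longrightarrow>
        (\<forall>(M :: ('n, 'Al, 'Fl, 'a, 's) interp) v s.
           models M Dl \<and> assignment v \<and> Do M v (refine_seq m as) (S0 M) s \<longrightarrow>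
           (\<forall>u s'. assignment u \<longrightarrow>
              (Do M u (m_a m A) s s' \<longleftrightarrow>
               (\<exists>e \<in> Reaction. Do M (u\<lparr>rvar := (rvar u)(0 := e)\<rparr>) (m_s m A) s s')))))"

definition m_isomorphic ::
  "('n::standard_name, 'Ah, 'Fh) bat \<Rightarrow> ('n, 'Ah, 'Fh, 'Al, 'Fl) mapping \<Rightarrow>
   ('n, 'Ah, 'Fh, 'ah, 'sh) interp \<Rightarrow> ('n, 'Al, 'Fl, 'al, 'sl) interp \<Rightarrow> 'sh \<Rightarrow> 'sl \<Rightarrow> bool" where
  "m_isomorphic Dh m Mh Ml sh sl \<longleftrightarrow>
     (\<forall>F \<in> fluents Dh. \<forall>v wh wl. assignment v \<longrightarrow>
        (sat Mh v wh sh (generic_flu Dh F) \<longleftrightarrow> sat Ml v wl sl (m_f m F)))"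

definition m_bisimulation ::
  "('n::standard_name, 'Ah, 'Fh) bat \<Rightarrow> ('n, 'Ah, 'Fh, 'Al, 'Fl) mapping \<Rightarrow>
   ('n, 'Ah, 'Fh, 'ah, 'sh) interp \<Rightarrow> ('n, 'Al, 'Fl, 'al, 'sl) interp \<Rightarrow> ('sh \<times> 'sl) set \<Rightarrow> bool" where
  "m_bisimulation Dh m Mh Ml B \<longleftrightarrow>
     (\<forall>(sh, sl) \<in> B.
        m_isomorphic Dh m Mh Ml sh sl \<and>
        (\<forall>A \<in> actions Dh. \<forall>v sh'. assignment v \<and>
           Poss Mh (val_sysact Mh v (generic_act Dh A)) sh \<and>
           sh' = result Mh (val_sysact Mh v (generic_act Dh A)) sh \<longrightarrow>
           (\<exists>sl'. Do Ml v (m_s m A) sl sl' \<and> (sh', sl') \<in> B)) \<and>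
        (\<forall>A \<in> actions Dh. \<forall>v sl'. assignment v \<and> Do Ml v (m_s m A) sl sl' \<longrightarrow>
           (\<exists>sh'. Poss Mh (val_sysact Mh v (generic_act Dh A)) sh \<and>
              sh' = result Mh (val_sysact Mh v (generic_act Dh A)) sh \<and> (sh', sl') \<in> B)))"

definition m_bisimilar ::
  "('n::standard_name, 'Ah, 'Fh) bat \<Rightarrow> ('n, 'Ah, 'Fh, 'Al, 'Fl) mapping \<Rightarrow>
   ('n, 'Ah, 'Fh, 'ah, 'sh) interp \<Rightarrow> ('n, 'Al, 'Fl, 'al, 'sl) interp \<Rightarrow> bool" where
  "m_bisimilar Dh m Mh Ml \<longleftrightarrow> (\<exists>B. m_bisimulation Dh m Mh Ml B \<and> (S0 Mh, S0 Ml) \<in> B)"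

end

theory Submission
  imports Defs
begin

text \<open>
  A bisimulation matches each executable high-level action step with a run of its refinement, so
  by induction on the action sequence the runs of the refined sequence from the initial situation
  end exactly in situations bisimilar to the high-level result, and runs exist iff the high-level
  sequence is executable. Bisimilar situations agree on all fluents, hence on all formulas. The
  bisimulation only speaks about generic actions and fluents under an arbitrary assignment;
  substitution lemmas transfer this to actual argument terms.
\<close>

section \<open>Substitution\<close>

text \<open>A lifted term never mentions \<open>OVar 0\<close>, and \<open>underO f\<close> lifts
  the image of every other variable.\<close>

lemma subst_tm_liftO: "subst_tm (underO f) (liftO \<circ> g) (liftO t) = liftO (subst_tm f g t)"
  by (cases t) auto

lemma subst_tm_liftR: "subst_tm (liftR \<circ> f) (underR g) (liftR t) = liftR (subst_tm f g t)"
  by (cases t) auto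

lemma subst_tm_subst_tm:
  "subst_tm f' g' (subst_tm f g t) = subst_tm (subst_tm f' g' \<circ> f) (subst_tm f' g' \<circ> g) t"
  by (cases t) auto

lemma subst_tm_comp_subst_tm:
  "subst_tm f' g' \<circ> subst_tm f g = subst_tm (subst_tm f' g' \<circ> f) (subst_tm f' g' \<circ> g)"
  by (simp add: fun_eq_iff subst_tm_subst_tm)

text \<open>The object and the reaction component of a composite under an object binder; they close
  the binder cases when substitutions in formulas and programs are composed.\<close>

lemma subst_tm_comp_underO:
  "subst_tm (underO f') (liftO \<circ> g') \<circ> underO f = underO (subst_tm f' g' \<circ> f)"
  "subst_tm (underO f') (liftO \<circ> g') \<circ> (liftO \<circ> g) = liftO \<circ> (subst_tm f' g' \<circ> g)"
  by (auto simp: fun_eq_iff subst_tm_liftO split: nat.split)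

lemma subst_tm_comp_underR:
  "subst_tm (liftR \<circ> f') (underR g') \<circ> underR g = underR (subst_tm f' g' \<circ> g)"
  "subst_tm (liftR \<circ> f') (underR g') \<circ> (liftR \<circ> f) = liftR \<circ> (subst_tm f' g' \<circ> f)"
  by (auto simp: fun_eq_iff subst_tm_liftR split: nat.split)

lemma subst_sysact_subst_sysact:
  "subst_sysact f' g' (subst_sysact f g a) =
   subst_sysact (subst_tm f' g' \<circ> f) (subst_tm f' g' \<circ> g) a"
  by (cases a) (auto simp: subst_tm_subst_tm)

lemma subst_aterm_subst_aterm:
  "subst_aterm f' g' (subst_aterm f g a) =
   subst_aterm (subst_tm f' g' \<circ> f) (subst_tm f' g' \<circ> g) a"
  by (cases a) (auto simp: subst_sysact_subst_sysact)

lemma subst_fm_subst_fm: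
  "subst_fm f' g' (subst_fm f g p) = subst_fm (subst_tm f' g' \<circ> f) (subst_tm f' g' \<circ> g) p"
  by (induction p arbitrary: f g f' g')
    (simp_all add: subst_tm_subst_tm subst_tm_comp_subst_tm subst_aterm_subst_aterm subst_tm_comp_underO
      subst_tm_comp_underR del: comp_apply)

lemma subst_prog_subst_prog:
  "subst_prog f' g' (subst_prog f g d) = subst_prog (subst_tm f' g' \<circ> f) (subst_tm f' g' \<circ> g) d"
  by (induction d arbitrary: f g f' g')
    (simp_all add: subst_tm_subst_tm subst_tm_comp_subst_tm subst_sysact_subst_sysact subst_fm_subst_fm
      subst_tm_comp_underO subst_tm_comp_underR del: comp_apply)

section \<open>Trading substitutions for changes of the assignment\<close>

definition subst_asg ::
  "(nat \<Rightarrow> 'n tm) \<Rightarrow> (nat \<Rightarrow> 'n tm) \<Rightarrow> 'n asg \<Rightarrow> 'n asg" where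
  "subst_asg f g v = \<lparr>ovar = val v \<circ> f, rvar = val v \<circ> g\<rparr>"

lemma subst_tm_Name: "subst_tm (Name \<circ> ovar v) (Name \<circ> rvar v) t = Name (val v t)"
  by (cases t) auto

text \<open>Instantiation substitutes names, so it composes with \<open>f\<close> and
  \<open>g\<close> into one substitution, which sends each variable to the name of its value under
  \<open>subst_asg f g v\<close>.\<close>

lemma instantiate_subst_prog:
  "instantiate v (subst_prog f g d) = instantiate (subst_asg f g v) d"
proof -
  have "subst_tm (Name \<circ> ovar v) (Name \<circ> rvar v) \<circ> h = Name \<circ> (val v \<circ> h)" for h :: "nat \<Rightarrow> 'a tm"
    by (simp add: fun_eq_iff subst_tm_Name)
  then show ?thesis
    by (simp add: instantiate_def subst_prog_subst_prog subst_asg_def)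
qed

lemma val_subst_tm: "val v (subst_tm f g t) = val (subst_asg f g v) t"
  by (cases t) (auto simp: subst_asg_def)

lemma val_sysact_subst_sysact:
  "val_sysact M v (subst_sysact f g a) = val_sysact M (subst_asg f g v) a"
  by (cases a) (simp add: val_subst_tm comp_def)

lemma val_aterm_subst_aterm:
  "val_aterm M v w (subst_aterm f g a) = val_aterm M (subst_asg f g v) w a"
  by (cases a) (simp_all add: val_sysact_subst_sysact)

lemma val_liftO: "val (v\<lparr>ovar := case_nat d (ovar v)\<rparr>) (liftO t) = val v t"
  by (cases t) auto

lemma val_liftR: "val (v\<lparr>rvar := case_nat d (rvar v)\<rparr>) (liftR t) = val v t"
  by (cases t) auto

lemma subst_asg_underO:
  "subst_asg (underO f) (liftO \<circ> g) (v\<lparr>ovar := case_nat d (ovar v)\<rparr>) =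
   (subst_asg f g v)\<lparr>ovar := case_nat d (ovar (subst_asg f g v))\<rparr>"
  by (auto simp: subst_asg_def fun_eq_iff val_liftO split: nat.split)

lemma subst_asg_underR:
  "subst_asg (liftR \<circ> f) (underR g) (v\<lparr>rvar := case_nat d (rvar v)\<rparr>) =
   (subst_asg f g v)\<lparr>rvar := case_nat d (rvar (subst_asg f g v))\<rparr>"
  by (auto simp: subst_asg_def fun_eq_iff val_liftR split: nat.split)

lemma sat_subst_fm: "sat M v w s (subst_fm f g p) \<longleftrightarrow> sat M (subst_asg f g v) w s p"
  \<comment> \<open>Only the composition that fusing the two maps creates in the \<open>Rel\<close>
    case is unfolded; \<open>liftO \<circ> f\<close> stays intact for
    \<open>subst_asg_underO\<close> to match.\<close>
  by (induction p arbitrary: f g v w)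
    (simp_all add: val_subst_tm val_aterm_subst_aterm subst_asg_underO subst_asg_underR comp_def
      [of "val v" "subst_tm f g" for v f g])

section \<open>Refinement of formulas\<close>

lemma assignment_case_nat:
  "assignment v \<Longrightarrow> d \<in> Reaction \<Longrightarrow> assignment (v\<lparr>rvar := case_nat d (rvar v)\<rparr>)"
  "assignment v \<Longrightarrow> assignment (v\<lparr>ovar := g\<rparr>)"
  by (auto simp: assignment_def split: nat.split)

text \<open>Links the parameter variables of a generic symbol to an actual argument list
  \<open>ts\<close>, for fluents and for actions alike.\<close>

lemma map_val_subst_asg_params:
  "map (val (subst_asg (\<lambda>x. if x < length ts then ts ! x else OVar x) g v)) (map OVar [0..<length ts])
   = map (val v) ts"
  by (rule nth_equalityI) (auto simp: subst_asg_def)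

text \<open>Both models quantify over the same standard names, so agreement on fluents extends
  through the connectives and quantifiers. \<open>object_fm\<close> keeps out action terms, whose
  domains in the two models are unrelated.\<close>

lemma m_isomorphic_sat_refine_fm:
  assumes iso: "m_isomorphic Dh m Mh Ml sh sl"
  shows "wf_fm Dh p \<Longrightarrow> object_fm p \<Longrightarrow> assignment v \<Longrightarrow>
    sat Ml v wl sl (refine_fm m p) \<longleftrightarrow> sat Mh v wh sh p"
proof (induction p arbitrary: v)
  case (Rel F ts)
  let ?f = "\<lambda>x. if x < length ts then ts ! x else OVar x"
  \<comment> \<open>Agreement is known only for the generic fluent; \<open>?u\<close> makes its
    parameters denote the values of \<open>ts\<close>.\<close>
  let ?u = "subst_asg ?f RVar v"
  have "assignment ?u"
    using Rel.prems by (simp add: assignment_def subst_asg_def)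
  then have "sat Ml ?u wl sl (m_f m F) \<longleftrightarrow> sat Mh ?u wh sh (generic_flu Dh F)"
    using iso Rel.prems by (auto simp: m_isomorphic_def)
  also have "\<dots> \<longleftrightarrow> sat Mh v wh sh (Rel F ts)"
    using Rel.prems map_val_subst_asg_params[of ts RVar v] by (simp add: generic_flu_def)
  finally show ?case
    by (simp add: sat_subst_fm)
qed (auto simp: assignment_case_nat)

section \<open>Executions of refined action sequences\<close>

lemma Trans_star_refl: "Trans_star M d s d s"
  by (simp add: Trans_star_def)

lemma Trans_star_step:
  "Trans M d s d' s' \<Longrightarrow> Trans_star M d' s' d'' s'' \<Longrightarrow> Trans_star M d s d'' s''"
  by (auto simp: Trans_star_def intro: converse_rtranclp_into_rtranclp)

lemma Trans_star_trans:
  "Trans_star M d s d' s' \<Longrightarrow> Trans_star M d' s' d'' s'' \<Longrightarrow> Trans_star M d s d'' s''"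
  by (auto simp: Trans_star_def)

text \<open>Steps are prepended while the end of the run stays fixed, because the axioms decompose
  the program at the start of a run.\<close>

lemma Trans_star_induct [consumes 1, case_names refl step]:
  assumes "Trans_star M d s d' s'"
    and "P d' s'"
    and "\<And>d s d1 s1. Trans M d s d1 s1 \<Longrightarrow> Trans_star M d1 s1 d' s' \<Longrightarrow> P d1 s1 \<Longrightarrow> P d s"
  shows "P d s"
  using assms(1) unfolding Trans_star_def
  by (induction rule: converse_rtranclp_induct2) (auto simp: assms(2) Trans_star_def intro: assms(3))

lemma Trans_star_cases:
  assumes "Trans_star M d s d' s'"
  obtains (refl) "d' = d" "s' = s"
    | (step) d1 s1 where "Trans M d s d1 s1" "Trans_star M d1 s1 d' s'"
  using assms unfolding Trans_star_def by (auto elim: converse_rtranclpE)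

section \<open>Runs of sequential compositions\<close>

lemma Trans_Seq:
  assumes "trans_axioms M"
  shows "Trans M (Seq d1 d2) s d' s' \<longleftrightarrow>
    (\<exists>d1'. Trans M d1 s d1' s' \<and> d' = Seq d1' d2) \<or> Final M d1 s \<and> Trans M d2 s d' s'"
  using assms by (simp add: trans_axioms_def)

lemma Final_Seq:
  assumes "final_axioms M"
  shows "Final M (Seq d1 d2) s \<longleftrightarrow> Final M d1 s \<and> Final M d2 s"
  using assms by (simp add: final_axioms_def)

lemma Trans_star_Seq_left:
  assumes "trans_axioms M" and "Trans_star M d1 s d1' s'"
  shows "Trans_star M (Seq d1 d2) s (Seq d1' d2) s'"
  using assms(2)
proof (induction rule: Trans_star_induct)
  case refl
  show ?case by (rule Trans_star_refl)
next
  case (step d s e s1)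
  have "Trans M (Seq d d2) s (Seq e d2) s1"
    using step.hyps(1) by (simp add: Trans_Seq[OF assms(1)])
  then show ?case
    using step.IH by (rule Trans_star_step)
qed

text \<open>The program remains a \<open>Seq\<close> with second part \<open>d2\<close> as long as
  the first part moves; control passes to \<open>d2\<close> once, at a moment when the first part is
  final. If this never happens, finality of the whole supplies an empty run of
  \<open>d2\<close>.\<close>

lemma Trans_star_Seq_Final:
  assumes "trans_axioms M" "final_axioms M"
    and "Trans_star M (Seq d1 d2) s d' s'" "Final M d' s'"
  shows "\<exists>d1' s1 d2'. Trans_star M d1 s d1' s1 \<and> Final M d1' s1 \<and>
    Trans_star M d2 s1 d2' s' \<and> Final M d2' s'"
proof -
  \<comment> \<open>The start program becomes a variable tied to \<open>Seq\<close> by an equation,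
    with \<open>d1\<close> generalised, since the first part changes along the run.\<close>
  have "d = Seq d1 d2 \<Longrightarrow> ?thesis" if "Trans_star M d s d' s'" for d
    using that
  proof (induction arbitrary: d1 rule: Trans_star_induct)
    case refl
    then have "Final M d1 s'" "Final M d2 s'"
      using assms(2,4) by (simp_all add: Final_Seq)
    then show ?case
      using Trans_star_refl[of M d1 s'] Trans_star_refl[of M d2 s'] by auto
  next
    case (step d s e s1)
    from step.hyps(1) step.prems consider
        d1' where "Trans M d1 s d1' s1" "e = Seq d1' d2"
      | "Final M d1 s" "Trans M d2 s e s1"
      by (auto simp: Trans_Seq[OF assms(1)])
    then show ?case
    proof cases
      case 1
      then show ?thesis
        using step.IH[OF 1(2)] Trans_star_step[OF 1(1)] by blast
    next
      case 2
      then show ?thesis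
        using Trans_star_refl[of M d1 s] Trans_star_step[OF 2(2) step.hyps(2)] assms(4) by blast
    qed
  qed
  then show ?thesis
    using assms(3) by blast
qed

lemma Do_Seq:
  assumes "trans_axioms M" "final_axioms M"
  shows "Do M v (Seq d1 d2) s s' \<longleftrightarrow> (\<exists>s1. Do M v d1 s s1 \<and> Do M v d2 s1 s')"
proof
  assume "Do M v (Seq d1 d2) s s'"
  then show "\<exists>s1. Do M v d1 s s1 \<and> Do M v d2 s1 s'"
    using Trans_star_Seq_Final[OF assms] unfolding Do_def
    by (fastforce simp: instantiate_def)
next
  let ?d1 = "instantiate v d1" and ?d2 = "instantiate v d2"
  assume "\<exists>s1. Do M v d1 s s1 \<and> Do M v d2 s1 s'"
  then obtain s1 d1' d2' where
    d1: "Trans_star M ?d1 s d1' s1" "Final M d1' s1" and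
    d2: "Trans_star M ?d2 s1 d2' s'" "Final M d2' s'"
    by (auto simp: Do_def)
  have left: "Trans_star M (Seq ?d1 ?d2) s (Seq d1' ?d2) s1"
    using assms(1) d1(1) by (rule Trans_star_Seq_left)
  \<comment> \<open>Passing control is no transition of its own but is merged into the first step of
    \<open>?d2\<close>. If \<open>?d2\<close> makes no step, the run stops at
    \<open>Seq d1' ?d2\<close>, which is final because both parts are.\<close>
  have "\<exists>d'. Trans_star M (Seq ?d1 ?d2) s d' s' \<and> Final M d' s'"
    using d2(1)
  proof (cases rule: Trans_star_cases)
    case refl
    then show ?thesis
      using left d1(2) d2(2) Final_Seq[OF assms(2)] by blast
  next
    case (step e s2)
    have "Trans M (Seq d1' ?d2) s1 e s2"
      using step(1) d1(2) by (simp add: Trans_Seq[OF assms(1)])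
    then have "Trans_star M (Seq ?d1 ?d2) s d2' s'"
      using left step(2) Trans_star_step Trans_star_trans by metis
    then show ?thesis
      using d2(2) by blast
  qed
  then show "Do M v (Seq d1 d2) s s'"
    by (simp add: Do_def instantiate_def)
qed

lemma Do_nil_prog:
  assumes "trans_axioms M" "final_axioms M" "assignment v"
  shows "Do M v nil_prog s s' \<longleftrightarrow> s' = s"
proof -
  have "\<not> Trans M nil_prog s d' s'" for s d' s'
    using assms(1) by (simp add: trans_axioms_def)
  then have "Trans_star M nil_prog s d' s' \<longleftrightarrow> d' = nil_prog \<and> s' = s" for d'
    using Trans_star_refl[of M nil_prog s] by (auto elim: Trans_star_cases)
  moreover have "Final M nil_prog s"
    \<comment> \<open>The \<open>Final\<close> axiom for tests speaks of well-sorted assignments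
      only; \<open>v\<close> provides one.\<close>
    using assms(2,3) unfolding final_axioms_def
    by (metis closed_fm.simps(1) sat.simps(1))
  ultimately show ?thesis
    by (auto simp: Do_def instantiate_def)
qed

text \<open>A one-element sequence is refined without a trailing \<open>nil_prog\<close>. As
  \<open>nil_prog\<close> only runs in place, the same recursion covers that case too.\<close>

lemma Do_refine_seq_Cons:
  assumes "trans_axioms M" "final_axioms M" "assignment v"
  shows "Do M v (refine_seq m (a # as)) s s' \<longleftrightarrow>
    (\<exists>s1. Do M v (refine_act m a) s s1 \<and> Do M v (refine_seq m as) s1 s')"
  using assms by (cases as) (simp_all add: Do_nil_prog Do_Seq)

text \<open>Mirrors the substitution in \<open>refine_act\<close>: under this assignment the
  parameters of the generic action denote the actual arguments and reaction.\<close>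

definition act_asg :: "('n, 'A) sysact \<Rightarrow> 'n asg \<Rightarrow> 'n asg" where
  "act_asg a v = (case a of Sys A ts e \<Rightarrow>
     subst_asg (\<lambda>x. if x < length ts then ts ! x else OVar x) (\<lambda>x. if x = 0 then e else RVar x) v)"

lemma Do_refine_act: "Do M v (refine_act m (Sys A ts e)) s s' \<longleftrightarrow>
    Do M (act_asg (Sys A ts e) v) (m_s m A) s s'"
  by (simp add: Do_def instantiate_subst_prog act_asg_def)

lemma val_sysact_generic_act:
  assumes "wf_sysact D (Sys A ts e)"
  shows "val_sysact M (act_asg (Sys A ts e) v) (generic_act D A) = val_sysact M v (Sys A ts e)"
proof -
  have "rvar (act_asg (Sys A ts e) v) 0 = val v e"
    by (simp add: act_asg_def subst_asg_def)
  moreover have "map (val (act_asg (Sys A ts e) v)) (map OVar [0..<act_arity D A]) = map (val v) ts"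
    using assms map_val_subst_asg_params[of ts] by (simp add: act_asg_def)
  ultimately show ?thesis
    by (simp add: generic_act_def del: map_map)
qed

text \<open>Well-formedness makes \<open>e\<close> a term of sort Reaction, so reaction variable 0
  keeps a value of its sort.\<close>

lemma assignment_act_asg:
  assumes "wf_sysact D a" "assignment v"
  shows "assignment (act_asg a v)"
proof (cases a)
  case (Sys A ts e)
  then have "val v e \<in> Reaction"
    using assms by (cases e) (auto simp: assignment_def)
  then show ?thesis
    using Sys assms by (auto simp: act_asg_def assignment_def subst_asg_def)
qed

section \<open>Executability and bisimulation\<close>

text \<open>Every situation precedes its successors and nothing precedes \<open>S0 M\<close>, so the
  initial situation is no successor and the condition is vacuous.\<close>

lemma Executable_S0:
  assumes "foundational_axioms M"
  shows "Executable M (S0 M)"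
proof -
  have "prec M s (result M a s)" for a s
    using assms by (simp add: foundational_axioms_def prec_eq_def)
  then have "result M a s \<noteq> S0 M" for a s
    using assms unfolding foundational_axioms_def by metis
  then show ?thesis
    using assms by (simp add: Executable_def prec_eq_def foundational_axioms_def)
qed

lemma Executable_result:
  assumes "foundational_axioms M"
  shows "Executable M (result M a s) \<longleftrightarrow> Executable M s \<and> Poss M a s"
proof -
  \<comment> \<open>Going from \<open>s\<close> to \<open>result M a s\<close> adds just one
    situation to the history, and injectivity of \<open>result\<close> identifies its last action
    and predecessor.\<close>
  have "prec_eq M (result M b t) (result M a s) \<longleftrightarrow>
      prec_eq M (result M b t) s \<or> b = a \<and> t = s" for b t
    using assms unfolding foundational_axioms_def prec_eq_def by metis
  then show ?thesis
    unfolding Executable_def by auto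
qed

lemma Executable_result_seqD:
  assumes "foundational_axioms M"
  shows "Executable M (result_seq M v as s) \<Longrightarrow> Executable M s"
proof (induction as arbitrary: s)
  case (Cons a as)
  then have "Executable M (result M (val_sysact M v a) s)"
    by (simp add: result_seq_def)
  then show ?case
    by (simp add: Executable_result[OF assms])
qed (simp add: result_seq_def)

text \<open>The back and forth clauses for the generic action, used at the assignment
  \<open>act_asg a v\<close>, give the same clauses for an action with arbitrary argument
  terms.\<close>

lemma m_bisimulation_refine_act:
  assumes bis: "m_bisimulation Dh m Mh Ml B" and B: "(sh, sl) \<in> B"
    and wf: "wf_sysact Dh a" and v: "assignment v"
  shows "Do Ml v (refine_act m a) sl sl' \<Longrightarrow>
      Poss Mh (val_sysact Mh v a) sh \<and> (result Mh (val_sysact Mh v a) sh, sl') \<in> B"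
    and "Poss Mh (val_sysact Mh v a) sh \<Longrightarrow>
      \<exists>sl'. Do Ml v (refine_act m a) sl sl' \<and> (result Mh (val_sysact Mh v a) sh, sl') \<in> B"
proof -
  obtain A ts e where a: "a = Sys A ts e"
    by (cases a)
  let ?u = "act_asg a v"
  have A: "A \<in> actions Dh"
    using wf a by simp
  have u: "assignment ?u"
    using wf v by (rule assignment_act_asg)
  have val: "val_sysact Mh ?u (generic_act Dh A) = val_sysact Mh v a"
    using wf unfolding a by (rule val_sysact_generic_act)
  have Do: "Do Ml v (refine_act m a) sl t \<longleftrightarrow> Do Ml ?u (m_s m A) sl t" for t
    unfolding a by (rule Do_refine_act)
  show "Poss Mh (val_sysact Mh v a) sh \<and> (result Mh (val_sysact Mh v a) sh, sl') \<in> B"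
    if "Do Ml v (refine_act m a) sl sl'"
    using bis B A u that unfolding m_bisimulation_def Do val[symmetric] by blast
  show "\<exists>sl'. Do Ml v (refine_act m a) sl sl' \<and> (result Mh (val_sysact Mh v a) sh, sl') \<in> B"
    if "Poss Mh (val_sysact Mh v a) sh"
    using bis B A u that unfolding m_bisimulation_def Do val[symmetric] by blast
qed

text \<open>Every low-level run is tracked by the back clause, one action at a time; executability
  is carried forward from \<open>sh\<close>.\<close>

lemma m_bisimulation_refine_seq_sound:
  assumes "foundational_axioms Mh" "trans_axioms Ml" "final_axioms Ml"
    and "m_bisimulation Dh m Mh Ml B" "assignment v"
  shows "(sh, sl) \<in> B \<Longrightarrow> \<forall>a \<in> set as. wf_sysact Dh a \<Longrightarrow> Executable Mh sh \<Longrightarrow>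
    Do Ml v (refine_seq m as) sl sl' \<Longrightarrow>
    Executable Mh (result_seq Mh v as sh) \<and> (result_seq Mh v as sh, sl') \<in> B"
proof (induction as arbitrary: sh sl)
  case Nil
  then show ?case
    using assms by (simp add: Do_nil_prog result_seq_def)
next
  case (Cons a as)
  let ?sh1 = "result Mh (val_sysact Mh v a) sh"
  obtain sl1 where sl1: "Do Ml v (refine_act m a) sl sl1" "Do Ml v (refine_seq m as) sl1 sl'"
    using Cons.prems(4) assms by (auto simp: Do_refine_seq_Cons)
  have "Poss Mh (val_sysact Mh v a) sh" and B: "(?sh1, sl1) \<in> B"
    using m_bisimulation_refine_act(1)[OF assms(4) Cons.prems(1) _ assms(5) sl1(1)]
      Cons.prems(2) by auto
  then have "Executable Mh ?sh1"
    using Cons.prems(3) assms(1) by (simp add: Executable_result)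
  then show ?case
    using Cons.IH[OF B _ _ sl1(2)] Cons.prems(2) by (simp add: result_seq_def)
qed

text \<open>The forth clause builds a run action by action. Executability is assumed at the end and
  passed back to prefixes, which yields \<open>Poss\<close> for the first action.\<close>

lemma m_bisimulation_refine_seq_complete:
  assumes "foundational_axioms Mh" "trans_axioms Ml" "final_axioms Ml"
    and "m_bisimulation Dh m Mh Ml B" "assignment v"
  shows "(sh, sl) \<in> B \<Longrightarrow> \<forall>a \<in> set as. wf_sysact Dh a \<Longrightarrow>
    Executable Mh (result_seq Mh v as sh) \<Longrightarrow>
    \<exists>sl'. Do Ml v (refine_seq m as) sl sl' \<and> (result_seq Mh v as sh, sl') \<in> B"
proof (induction as arbitrary: sh sl)
  case Nil
  then show ?case
    using assms by (simp add: Do_nil_prog result_seq_def)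
next
  case (Cons a as)
  let ?sh1 = "result Mh (val_sysact Mh v a) sh"
  have seq: "result_seq Mh v (a # as) sh = result_seq Mh v as ?sh1"
    by (simp add: result_seq_def)
  have "Executable Mh ?sh1"
    using Cons.prems(3) Executable_result_seqD[OF assms(1)] unfolding seq by blast
  then have "Poss Mh (val_sysact Mh v a) sh"
    using assms(1) by (simp add: Executable_result)
  then obtain sl1 where sl1: "Do Ml v (refine_act m a) sl sl1" "(?sh1, sl1) \<in> B"
    using m_bisimulation_refine_act(2)[OF assms(4) Cons.prems(1) _ assms(5), of a]
      Cons.prems(2) by auto
  then show ?case
    using Cons.IH[OF sl1(2)] Cons.prems(2,3) assms unfolding seq
    by (auto simp: Do_refine_seq_Cons)
qed

theorem theorem4:
  fixes Dh :: "('n::standard_name, 'Ah, 'Fh) bat"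
    and Dl :: "('n, 'Al, 'Fl) bat"
    and m :: "('n, 'Ah, 'Fh, 'Al, 'Fl) mapping"
    and Mh :: "('n, 'Ah, 'Fh, 'ah, 'sh) interp"
    and Ml :: "('n, 'Al, 'Fl, 'al, 'sl) interp"
    and as :: "('n, 'Ah) sysact list"
    and \<phi> :: "('n, 'Ah, 'Fh) fm"
    and v :: "'n asg"
    and wh :: "nat \<Rightarrow> 'ah"
    and wl :: "nat \<Rightarrow> 'al"
  assumes "ndbat TYPE('ah \<times> 'sh) Dh"
    and "finite (actions Dh)" and "finite (fluents Dh)"
    and "ndbat TYPE('al \<times> 'sl) Dl"
    and "refinement_mapping TYPE('al \<times> 'sl) Dh Dl m"
    and "proper TYPE('al \<times> 'sl) Dh Dl m"
    and "models Mh Dh"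
    and "models Ml Dl"
    and "m_bisimilar Dh m Mh Ml"
    and "\<forall>a \<in> set as. wf_sysact Dh a"
    and "wf_fm Dh \<phi>" and "object_fm \<phi>"
    and "assignment v"
  shows "(\<exists>s'. Do Ml v (refine_seq m as) (S0 Ml) s' \<and> sat Ml v wl s' (refine_fm m \<phi>)) \<longleftrightarrow>
         Executable Mh (result_seq Mh v as (S0 Mh)) \<and>
         sat Mh v wh (result_seq Mh v as (S0 Mh)) \<phi>"
proof -
  let ?sh = "result_seq Mh v as (S0 Mh)"
  obtain B where bis: "m_bisimulation Dh m Mh Ml B" and S0: "(S0 Mh, S0 Ml) \<in> B"
    using \<open>m_bisimilar Dh m Mh Ml\<close> by (auto simp: m_bisimilar_def)
  have Mh: "foundational_axioms Mh"
    using \<open>models Mh Dh\<close> by (simp add: models_def models_bat_def)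
  have Ml: "trans_axioms Ml" "final_axioms Ml"
    using \<open>models Ml Dl\<close> by (simp_all add: models_def)
  note ax = Mh Ml bis \<open>assignment v\<close>
  have fm: "sat Ml v wl sl (refine_fm m \<phi>) \<longleftrightarrow> sat Mh v wh sh \<phi>" if "(sh, sl) \<in> B" for sh sl
  proof -
    have "m_isomorphic Dh m Mh Ml sh sl"
      using bis that by (auto simp: m_bisimulation_def)
    then show ?thesis
      using \<open>wf_fm Dh \<phi>\<close> \<open>object_fm \<phi>\<close> \<open>assignment v\<close> by (rule m_isomorphic_sat_refine_fm)
  qed
  show ?thesis
  proof
    assume "\<exists>s'. Do Ml v (refine_seq m as) (S0 Ml) s' \<and> sat Ml v wl s' (refine_fm m \<phi>)"
    then obtain s' where s': "Do Ml v (refine_seq m as) (S0 Ml) s'" "sat Ml v wl s' (refine_fm m \<phi>)"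
      by blast
    \<comment> \<open>Soundness covers all runs, so it applies to the very \<open>s'\<close> in
      which the refined formula holds.\<close>
    have "Executable Mh ?sh \<and> (?sh, s') \<in> B"
      using m_bisimulation_refine_seq_sound[OF ax S0] assms(10) Executable_S0[OF Mh] s'(1)
      by blast
    then show "Executable Mh ?sh \<and> sat Mh v wh ?sh \<phi>"
      using fm s'(2) by blast
  next
    assume "Executable Mh ?sh \<and> sat Mh v wh ?sh \<phi>"
    then show "\<exists>s'. Do Ml v (refine_seq m as) (S0 Ml) s' \<and> sat Ml v wl s' (refine_fm m \<phi>)"
      \<comment> \<open>The run ends in some situation bisimilar to \<open>?sh\<close>, and
        bisimilarity alone lets \<open>fm\<close> transfer the formula there.\<close>
      using m_bisimulation_refine_seq_complete[OF ax S0 assms(10)] fm by blast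
  qed
qed

end
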